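(* Let $E,F,G,H$ be Banach spaces with a continuous bilinear map $F\times G\to H$ denoted by juxtaposition, let $S$ be a set, $\mathcal A$ an algebra of subsets of $S$, and $\mu:\mathcal A\to G$ a finitely additive map. Assume that the elementary integral $$\mathcal E(S,F)\ni f\mapsto \int_S f\mu\in H$$ has a continuous (linear) extension to some normed space $I$ of integrands: $$I\ni f\mapsto \int_S f\mu\in H .$$ If $E$ is non-trivial (i.e. $E\neq\{0\}$), then the linear operator $$L(E,I)\ni f\mapsto \Big(E\ni e\mapsto \int_S f(e)\mu\in H\Big)\in L(E,H)$$ has the same operator norm as the integral $I\ni f\mapsto\int_S f\mu\in H$.
   Context: For normed spaces $V,W$, $L(V,W)$ denotes the space of continuous linear operators $V\to W$ with the operator norm. An elementary function is a function $f:S\to F$ of finite range of the form $f=\sum_{i=1}^n f_i\mathbf 1_{A_i}$ with $n\in\mathbb N$, $f_i\in F$, $A_i\in\mathcal A$; the set of elementary functions is $\mathcal E(S,F)$. The elementary integral of $\mu$ is the linear operator $\mathcal E(S,F)\to H$, $f\mapsto\int_S f\mu:=\sum_{i=1}^n f_i\,\mu(A_i)$. A normed space $I$ of integrands is a normed space containing the elementary functions (possibly after identification of functions modulo null sets), and the extension to $I$ is a continuous linear operator $I\to H$ which agrees with the elementary integral on elementary functions; it is again denoted $f\mapsto\int_S f\mu$. The operator on $L(E,I)$ in the claim is called the cylindrified integral. *)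

theory Defs
  imports "HOL-Analysis.Analysis"
begin

(* Functions on S are functions on the whole type 's that vanish outside S; since the sets
   A i lie in the algebra M \<subseteq> Pow S, the functions below do this automatically. *)
definition elementary_rep ::
    "'s set set \<Rightarrow> ('s \<Rightarrow> 'f::real_vector) \<Rightarrow> nat \<Rightarrow> (nat \<Rightarrow> 'f) \<Rightarrow> (nat \<Rightarrow> 's set) \<Rightarrow> bool" where
  "elementary_rep M f n c A \<longleftrightarrow>
     (\<forall>i<n. A i \<in> M) \<and> f = (\<lambda>s. \<Sum>i<n. indicator (A i) s *\<^sub>R c i)"

definition elementary_functions :: "'s set set \<Rightarrow> ('s \<Rightarrow> 'f::real_vector) set" where
  "elementary_functions M = {f. \<exists>n c A. elementary_rep M f n c A}"

(* The description is well defined by elementary_integral_eq below. *)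
definition elementary_integral ::
    "('f::real_vector \<Rightarrow> 'g \<Rightarrow> 'h::real_vector) \<Rightarrow> 's set set \<Rightarrow> ('s set \<Rightarrow> 'g) \<Rightarrow> ('s \<Rightarrow> 'f) \<Rightarrow> 'h" where
  "elementary_integral B M \<mu> f =
     (THE h. \<exists>n c A. elementary_rep M f n c A \<and> h = (\<Sum>i<n. B (c i) (\<mu> (A i))))"

definition null_ideal :: "'s set \<Rightarrow> 's set set \<Rightarrow> bool" where
  "null_ideal S N \<longleftrightarrow>
     N \<subseteq> Pow S \<and> {} \<in> N \<and> (\<forall>A\<in>N. \<forall>B\<subseteq>A. B \<in> N) \<and> (\<forall>A\<in>N. \<forall>B\<in>N. A \<union> B \<in> N)"

(* The normed space I is the whole type 'i.  It contains the elementary functions through the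
   linear map emb, which identifies exactly those that agree off a null set; N = {{}} gives an
   honest inclusion.  The values of emb at non-elementary functions are irrelevant. *)
definition integrand_space ::
    "'s set \<Rightarrow> 's set set \<Rightarrow> 's set set \<Rightarrow> (('s \<Rightarrow> 'f::real_vector) \<Rightarrow> 'i::real_normed_vector) \<Rightarrow> bool" where
  "integrand_space S M N emb \<longleftrightarrow>
     null_ideal S N \<and>
     (\<forall>f\<in>elementary_functions M. \<forall>g\<in>elementary_functions M.
        emb (\<lambda>s. f s + g s) = emb f + emb g) \<and>
     (\<forall>r. \<forall>f\<in>elementary_functions M. emb (\<lambda>s. r *\<^sub>R f s) = r *\<^sub>R emb f) \<and>
     (\<forall>f\<in>elementary_functions M. \<forall>g\<in>elementary_functions M.
        emb f = emb g \<longleftrightarrow> {s\<in>S. f s \<noteq> g s} \<in> N)"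

(* The continuous linear operator J : I \<rightarrow> H is the integral on I. *)
definition extends_elementary_integral ::
    "('f::real_vector \<Rightarrow> 'g \<Rightarrow> 'h::real_normed_vector) \<Rightarrow> 's set set \<Rightarrow> ('s set \<Rightarrow> 'g) \<Rightarrow>
     (('s \<Rightarrow> 'f) \<Rightarrow> 'i::real_normed_vector) \<Rightarrow> ('i \<Rightarrow>\<^sub>L 'h) \<Rightarrow> bool" where
  "extends_elementary_integral B M \<mu> emb J \<longleftrightarrow>
     (\<forall>f\<in>elementary_functions M. J (emb f) = elementary_integral B M \<mu> f)"

definition cylindrified_integral ::
    "('i::real_normed_vector \<Rightarrow>\<^sub>L 'h::real_normed_vector) \<Rightarrow>
     ('e::real_normed_vector \<Rightarrow>\<^sub>L 'i) \<Rightarrow> ('e \<Rightarrow>\<^sub>L 'h)" where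
  "cylindrified_integral J f = Blinfun (\<lambda>e. J (f e))"

lemma cylindrified_integral_apply: "cylindrified_integral J f e = J (f e)"
  unfolding cylindrified_integral_def
  by (simp add: bounded_linear_Blinfun_apply
      bounded_linear_compose[OF blinfun.bounded_linear_right blinfun.bounded_linear_right])

lemma elementary_sum_zero:
  fixes B :: "'f::real_normed_vector \<Rightarrow> 'g::real_normed_vector \<Rightarrow> 'h::real_normed_vector"
    and n :: nat
  assumes alg: "algebra S M" and add: "additive M \<mu>" and B: "bounded_bilinear B"
  shows "\<lbrakk>D \<in> M; \<forall>i<n. A i \<in> M; \<forall>s\<in>D. v + (\<Sum>i<n. indicator (A i) s *\<^sub>R c i) = 0\<rbrakk>
    \<Longrightarrow> B v (\<mu> D) + (\<Sum>i<n. B (c i) (\<mu> (A i \<inter> D))) = 0"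
proof (induction n arbitrary: D v)
  interpret algebra S M by (rule alg)
  interpret B: bounded_bilinear B by (rule B)
  case 0
  have "\<mu> {} = 0"
    using additiveD[OF add, of "{}" "{}"] by simp
  with 0 show ?case by (cases "D = {}") (auto simp: B.zero_left B.zero_right)
next
  interpret algebra S M by (rule alg)
  interpret B: bounded_bilinear B by (rule B)
  case (Suc n)
  have split: "\<mu> X = \<mu> (X \<inter> A n) + \<mu> (X - A n)" if "X \<in> M" for X
  proof -
    have "\<mu> ((X \<inter> A n) \<union> (X - A n)) = \<mu> (X \<inter> A n) + \<mu> (X - A n)"
      using that Suc.prems(2) by (intro additiveD[OF add]) auto
    then show ?thesis by (simp add: Int_Diff_Un)
  qed
  have 1: "B (v + c n) (\<mu> (D \<inter> A n)) + (\<Sum>i<n. B (c i) (\<mu> (A i \<inter> (D \<inter> A n)))) = 0"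
    using Suc.prems by (intro Suc.IH) (auto simp: algebra_simps)
  have 2: "B v (\<mu> (D - A n)) + (\<Sum>i<n. B (c i) (\<mu> (A i \<inter> (D - A n)))) = 0"
    using Suc.prems by (intro Suc.IH) auto
  have 3: "\<mu> (A i \<inter> D) = \<mu> (A i \<inter> (D \<inter> A n)) + \<mu> (A i \<inter> (D - A n))" if "i < n" for i
  proof -
    have "A i \<inter> D \<in> M"
      using Suc.prems(1,2) that by (intro Int) auto
    then show ?thesis
      using split[of "A i \<inter> D"] by (simp only: Int_assoc Int_Diff)
  qed
  have "(\<Sum>i<n. B (c i) (\<mu> (A i \<inter> D))) = (\<Sum>i<n. B (c i) (\<mu> (A i \<inter> (D \<inter> A n)))) +
      (\<Sum>i<n. B (c i) (\<mu> (A i \<inter> (D - A n))))"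
    by (simp add: 3 B.add_right sum.distrib)
  then have "B v (\<mu> D) + (\<Sum>i<Suc n. B (c i) (\<mu> (A i \<inter> D))) =
      (B (v + c n) (\<mu> (D \<inter> A n)) + (\<Sum>i<n. B (c i) (\<mu> (A i \<inter> (D \<inter> A n))))) +
      (B v (\<mu> (D - A n)) + (\<Sum>i<n. B (c i) (\<mu> (A i \<inter> (D - A n)))))"
    unfolding sum.lessThan_Suc split[OF Suc.prems(1)] B.add_right B.add_left Int_commute[of "A n" D]
    by (simp only: ac_simps)
  then show ?case
    unfolding 1 2 by simp
qed

lemma elementary_integral_eq:
  fixes B :: "'f::real_normed_vector \<Rightarrow> 'g::real_normed_vector \<Rightarrow> 'h::real_normed_vector"
  assumes alg: "algebra S M" and add: "additive M \<mu>" and B: "bounded_bilinear B"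
    and rep: "elementary_rep M f n c A"
  shows "elementary_integral B M \<mu> f = (\<Sum>i<n. B (c i) (\<mu> (A i)))"
  unfolding elementary_integral_def
proof (rule the_equality)
  show "\<exists>n' c' A'. elementary_rep M f n' c' A' \<and>
      (\<Sum>i<n. B (c i) (\<mu> (A i))) = (\<Sum>i<n'. B (c' i) (\<mu> (A' i)))"
    using rep by blast
next
  interpret algebra S M by (rule alg)
  interpret B: bounded_bilinear B by (rule B)
  fix h assume "\<exists>n c A. elementary_rep M f n c A \<and> h = (\<Sum>i<n. B (c i) (\<mu> (A i)))"
  then obtain m d C where rep': "elementary_rep M f m d C"
    and h: "h = (\<Sum>i<m. B (d i) (\<mu> (C i)))" by blast
  define c' where "c' i = (if i < n then c i else - d (i - n))" for i
  define A' where "A' i = (if i < n then A i else C (i - n))" for i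
  have concat: "(\<Sum>i<n+m. g i) = (\<Sum>i<n. g i) + (\<Sum>i<m. g (n + i))"
    for g :: "nat \<Rightarrow> 'z::comm_monoid_add"
    by (induction m) (auto simp: add.assoc)
  have M: "\<forall>i<n+m. A' i \<in> M"
    using rep rep' by (auto simp: A'_def elementary_rep_def)
  have eq: "(\<Sum>i<n. indicator (A i) s *\<^sub>R c i) = (\<Sum>i<m. indicator (C i) s *\<^sub>R d i)" for s
    using rep rep' unfolding elementary_rep_def by metis
  have "B 0 (\<mu> S) + (\<Sum>i<n+m. B (c' i) (\<mu> (A' i \<inter> S))) = 0"
    using M eq by (intro elementary_sum_zero[OF alg add B])
      (auto simp: concat c'_def A'_def sum_negf)
  moreover have "A' i \<inter> S = A' i" if "i < n + m" for i
    using M that by (intro Int_absorb2 sets_into_space) auto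
  ultimately have "(\<Sum>i<n+m. B (c' i) (\<mu> (A' i))) = 0"
    by (simp add: B.zero_left)
  then show "h = (\<Sum>i<n. B (c i) (\<mu> (A i)))"
    by (simp add: concat c'_def A'_def h B.minus_left sum_negf)
qed

end

theory Submission
  imports Defs
begin

text \<open>
  The upper bound is submultiplicativity of the operator norm, because the cylindrified integral
  is just \<open>f \<mapsto> J \<circ> f\<close>. For the lower bound, composition with \<open>J\<close> is tested on the operators of
  rank one \<open>e \<mapsto> \<phi> e *\<^sub>R x\<close>, where \<open>\<phi>\<close> is one fixed nonzero continuous functional on the
  space \<open>E\<close> and \<open>x\<close> runs through the space of integrands. Such an operator has norm
  \<open>\<parallel>\<phi>\<parallel> \<parallel>x\<parallel>\<close> and is sent to \<open>e \<mapsto> \<phi> e *\<^sub>R J x\<close>, which has norm \<open>\<parallel>\<phi>\<parallel> \<parallel>J x\<parallel>\<close>; the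
  factor \<open>\<parallel>\<phi>\<parallel>\<close> cancels, so \<open>J\<close> is bounded by the norm of the cylindrified integral.

  The substance is the existence of \<open>\<phi>\<close> on a nontrivial normed space, which is the
  Hahn--Banach theorem. It is proved by applying Zorn's lemma to sublinear functionals instead of
  partially defined linear ones: below every sublinear functional there is a minimal one
  (\<open>ex_minimal_sublinear\<close>), and a minimal sublinear functional is linear
  (\<open>minimal_sublinear_imp_linear\<close>). Both the linearity of minimal functionals and the
  nontriviality of \<open>\<phi>\<close> come from the same construction \<open>lower_along\<close>, which decreases a
  sublinear functional as far as a given direction permits.
\<close>

section \<open>Sublinear functionals\<close>

definition sublinear :: "('a::real_vector \<Rightarrow> real) \<Rightarrow> bool" where
  "sublinear p \<longleftrightarrow>
     (\<forall>x y. p (x + y) \<le> p x + p y) \<and> (\<forall>r\<ge>0. \<forall>x. p (r *\<^sub>R x) = r * p x)"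

lemma sublinear_add: "sublinear p \<Longrightarrow> p (x + y) \<le> p x + p y"
  by (simp add: sublinear_def)

lemma sublinear_scaleR: "sublinear p \<Longrightarrow> 0 \<le> r \<Longrightarrow> p (r *\<^sub>R x) = r * p x"
  by (simp add: sublinear_def)

lemma sublinear_zero: "sublinear p \<Longrightarrow> p 0 = 0"
  using sublinear_scaleR[of p 0 0] by simp

lemma sublinear_minus_ge: "sublinear p \<Longrightarrow> - p (- x) \<le> p x"
  using sublinear_add[of p x "- x"] sublinear_zero[of p] by simp

text \<open>One half of positive homogeneity suffices, since the other half is the same inequality for
  the inverse factor.\<close>

lemma sublinearI:
  assumes add: "\<And>x y. p (x + y) \<le> p x + p y"
    and zero: "p 0 = 0"
    and scale: "\<And>r x. 0 < r \<Longrightarrow> p (r *\<^sub>R x) \<le> r * p x"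
  shows "sublinear p"
  unfolding sublinear_def
proof (intro conjI allI impI add)
  fix r :: real and x assume "0 \<le> r"
  show "p (r *\<^sub>R x) = r * p x"
  proof (cases "r = 0")
    case True
    then show ?thesis by (simp add: zero)
  next
    case False
    with \<open>0 \<le> r\<close> have r: "0 < r" by simp
    have "p (inverse r *\<^sub>R (r *\<^sub>R x)) \<le> inverse r * p (r *\<^sub>R x)"
      using r by (intro scale) simp
    then have "r * p x \<le> p (r *\<^sub>R x)"
      using r by (simp add: field_simps)
    with scale[OF r, of x] show ?thesis by simp
  qed
qed

lemma sublinear_norm: "sublinear norm"
  by (rule sublinearI) (auto intro: norm_triangle_ineq)

section \<open>Lowering a sublinear functional along a direction\<close>

text \<open>The pointwise largest sublinear functional below \<open>p\<close> whose value at \<open>- e\<close> is the smallest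
  possible one, namely \<open>- p e\<close>.\<close>

definition lower_along :: "('a::real_vector \<Rightarrow> real) \<Rightarrow> 'a \<Rightarrow> 'a \<Rightarrow> real" where
  "lower_along p e x = (INF t\<in>{0..}. p (x + t *\<^sub>R e) - t * p e)"

lemma lower_along_le:
  assumes p: "sublinear p" and "0 \<le> t"
  shows "lower_along p e x \<le> p (x + t *\<^sub>R e) - t * p e"
  unfolding lower_along_def
proof (rule cINF_lower)
  show "bdd_below ((\<lambda>t. p (x + t *\<^sub>R e) - t * p e) ` {0..})"
  proof (rule bdd_belowI2)
    fix t :: real assume "t \<in> {0..}"
    then show "- p (- x) \<le> p (x + t *\<^sub>R e) - t * p e"
      using sublinear_add[OF p, of "x + t *\<^sub>R e" "- x"] sublinear_scaleR[OF p, of t e] by simp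
  qed
qed (use \<open>0 \<le> t\<close> in simp)

lemma lower_along_greatest:
  assumes "\<And>t. 0 \<le> t \<Longrightarrow> m \<le> p (x + t *\<^sub>R e) - t * p e"
  shows "m \<le> lower_along p e x"
  unfolding lower_along_def using assms by (intro cINF_greatest) auto

lemma sublinear_lower_along:
  assumes p: "sublinear p"
  shows "sublinear (lower_along p e)"
proof (rule sublinearI)
  fix x y
  have "lower_along p e (x + y) - (p (y + t *\<^sub>R e) - t * p e) \<le> lower_along p e x"
    if t: "0 \<le> t" for t
  proof (rule lower_along_greatest)
    fix s :: real assume s: "0 \<le> s"
    have "lower_along p e (x + y) \<le> p ((x + s *\<^sub>R e) + (y + t *\<^sub>R e)) - (s + t) * p e"
      using lower_along_le[OF p, of "s + t" e "x + y"] s t by (simp add: algebra_simps)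
    with sublinear_add[OF p, of "x + s *\<^sub>R e" "y + t *\<^sub>R e"]
    show "lower_along p e (x + y) - (p (y + t *\<^sub>R e) - t * p e) \<le> p (x + s *\<^sub>R e) - s * p e"
      by (simp add: algebra_simps)
  qed
  then have "lower_along p e (x + y) - lower_along p e x \<le> lower_along p e y"
    by (intro lower_along_greatest) (simp add: algebra_simps)
  then show "lower_along p e (x + y) \<le> lower_along p e x + lower_along p e y"
    by simp
next
  show "lower_along p e 0 = 0"
  proof (rule antisym)
    show "lower_along p e 0 \<le> 0"
      using lower_along_le[OF p, of 0 e 0] sublinear_zero[OF p] by simp
    show "0 \<le> lower_along p e 0"
      using p by (intro lower_along_greatest) (simp add: sublinear_scaleR)
  qed
next
  fix r :: real and x assume r: "0 < r"
  have "inverse r * lower_along p e (r *\<^sub>R x) \<le> lower_along p e x"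
  proof (rule lower_along_greatest)
    fix t :: real assume t: "0 \<le> t"
    have "lower_along p e (r *\<^sub>R x) \<le> p (r *\<^sub>R (x + t *\<^sub>R e)) - r * t * p e"
      using lower_along_le[OF p, of "r * t" e "r *\<^sub>R x"] r t by (simp add: algebra_simps)
    also have "\<dots> = r * (p (x + t *\<^sub>R e) - t * p e)"
      by (simp only: sublinear_scaleR[OF p less_imp_le[OF r]] right_diff_distrib mult.assoc)
    finally show "inverse r * lower_along p e (r *\<^sub>R x) \<le> p (x + t *\<^sub>R e) - t * p e"
      using r by (simp add: field_simps)
  qed
  then show "lower_along p e (r *\<^sub>R x) \<le> r * lower_along p e x"
    using r by (simp add: field_simps)
qed

lemma lower_along_le_self:
  assumes "sublinear p"
  shows "lower_along p e \<le> p"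
  using lower_along_le[OF assms, of 0 e] by (simp add: le_fun_def)

section \<open>The Hahn--Banach theorem\<close>

text \<open>A minimal \<open>p\<close> cannot be lowered along any \<open>e\<close>, so its value at \<open>x\<close> is at most
  \<open>p (x + e) - p e\<close>; together with subadditivity this is additivity.\<close>

lemma minimal_sublinear_imp_linear:
  assumes p: "sublinear p" and min: "\<And>q. sublinear q \<Longrightarrow> q \<le> p \<Longrightarrow> q = p"
  shows "linear p"
proof -
  have add: "p (x + e) = p x + p e" for x e
  proof -
    have "lower_along p e = p"
      using p by (intro min sublinear_lower_along lower_along_le_self)
    then have "p x \<le> p (x + e) - p e"
      using lower_along_le[OF p, of 1 e x] by simp
    with sublinear_add[OF p, of x e] show ?thesis by simp
  qed
  have minus: "p (- x) = - p x" for x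
    using add[of x "- x"] sublinear_zero[OF p] by simp
  have "p (r *\<^sub>R x) = r *\<^sub>R p x" for r x
  proof (cases "0 \<le> r")
    case True
    then show ?thesis by (simp add: sublinear_scaleR[OF p])
  next
    case False
    then show ?thesis
      using sublinear_scaleR[OF p, of "- r" x] minus[of "r *\<^sub>R x"] by simp
  qed
  with add show ?thesis by (intro linearI)
qed

text \<open>The pointwise infimum of a chain of sublinear functionals below \<open>p\<close> is finite, because all
  of them dominate \<open>x \<mapsto> - p (- x)\<close>, and it is subadditive because of any two members of a chain
  one lies below the other.\<close>

lemma chain_sublinear_lower_bound:
  assumes ne: "C \<noteq> {}"
    and C: "\<And>q. q \<in> C \<Longrightarrow> sublinear q \<and> q \<le> p"
    and chain: "\<And>q r. q \<in> C \<Longrightarrow> r \<in> C \<Longrightarrow> q \<le> r \<or> r \<le> q"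
  shows "\<exists>l. sublinear l \<and> l \<le> p \<and> (\<forall>q\<in>C. l \<le> q)"
proof -
  define l where "l x = (INF q\<in>C. q x)" for x
  have lower: "l x \<le> q x" if "q \<in> C" for q x
    unfolding l_def
  proof (rule cINF_lower[OF _ that], rule bdd_belowI2)
    fix r assume "r \<in> C"
    then have "- r (- x) \<le> r x" "r (- x) \<le> p (- x)"
      using C by (auto simp: sublinear_minus_ge le_fun_def)
    then show "- p (- x) \<le> r x" by simp
  qed
  have greatest: "m \<le> l x" if "\<And>q. q \<in> C \<Longrightarrow> m \<le> q x" for m x
    unfolding l_def using ne that by (rule cINF_greatest)
  have "sublinear l"
  proof (rule sublinearI)
    fix x y
    have two: "l (x + y) \<le> q x + r y" if q: "q \<in> C" and r: "r \<in> C" for q r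
    proof -
      obtain u where u: "u \<in> C" "u \<le> q" "u \<le> r"
        using chain[OF q r] q r by auto
      have "l (x + y) \<le> u (x + y)"
        using u by (intro lower)
      also have "\<dots> \<le> u x + u y"
        using u C by (intro sublinear_add) auto
      also have "\<dots> \<le> q x + r y"
        using u by (intro add_mono) (auto simp: le_fun_def)
      finally show ?thesis .
    qed
    have "l (x + y) - r y \<le> l x" if "r \<in> C" for r
      using two that by (intro greatest) (simp add: algebra_simps)
    then have "l (x + y) - l x \<le> l y"
      by (intro greatest) (simp add: algebra_simps)
    then show "l (x + y) \<le> l x + l y" by simp
  next
    show "l 0 = 0"
      using ne C by (simp add: l_def sublinear_zero)
  next
    fix r :: real and x assume r: "0 < r"
    have "inverse r * l (r *\<^sub>R x) \<le> l x"
    proof (rule greatest)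
      fix q assume q: "q \<in> C"
      with r C have "l (r *\<^sub>R x) \<le> r * q x"
        using lower[OF q, of "r *\<^sub>R x"] by (simp add: sublinear_scaleR)
      with r show "inverse r * l (r *\<^sub>R x) \<le> q x"
        by (simp add: field_simps)
    qed
    with r show "l (r *\<^sub>R x) \<le> r * l x"
      by (simp add: field_simps)
  qed
  moreover have "l \<le> p"
  proof -
    obtain q where "q \<in> C" using ne by blast
    then have "l \<le> q" "q \<le> p" using lower C by (auto simp: le_fun_def)
    then show ?thesis by (rule order_trans)
  qed
  ultimately show ?thesis
    using lower by (auto simp: le_fun_def)
qed

lemma ex_minimal_sublinear:
  assumes p: "sublinear p"
  shows "\<exists>m. sublinear m \<and> m \<le> p \<and> (\<forall>q. sublinear q \<longrightarrow> q \<le> m \<longrightarrow> q = m)"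
proof -
  let ?A = "{q. sublinear q \<and> q \<le> p}" and ?P = "\<lambda>q r :: 'a \<Rightarrow> real. r \<le> q"
  have "\<exists>m\<in>?A. \<forall>q\<in>?A. ?P m q \<longrightarrow> q = m"
  proof (rule predicate_Zorn)
    show "partial_order_on ?A (relation_of ?P ?A)"
      by (rule partial_order_on_relation_ofI) auto
  next
    fix C assume "C \<in> Chains (relation_of ?P ?A)"
    then have C: "\<And>q. q \<in> C \<Longrightarrow> sublinear q \<and> q \<le> p"
      and chain: "\<And>q r. q \<in> C \<Longrightarrow> r \<in> C \<Longrightarrow> q \<le> r \<or> r \<le> q"
      by (auto simp: Chains_def relation_of_def)
    show "\<exists>u\<in>?A. \<forall>q\<in>C. ?P q u"
    proof (cases "C = {}")
      case True
      with p show ?thesis by auto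
    next
      case False
      from chain_sublinear_lower_bound[OF this C chain] show ?thesis by auto
    qed
  qed
  then show ?thesis
    by (auto intro: order_trans)
qed

theorem hahn_banach_sublinear:
  assumes "sublinear p"
  shows "\<exists>\<phi>. linear \<phi> \<and> \<phi> \<le> p"
  using ex_minimal_sublinear[OF assms] minimal_sublinear_imp_linear by metis

text \<open>A linear functional below the norm could be zero. Below the norm lowered along \<open>e\<close> it
  cannot be zero, as the value at \<open>- e\<close> is then at most \<open>- norm e\<close>.\<close>

theorem ex_nonzero_functional:
  fixes e :: "'a::real_normed_vector"
  assumes "e \<noteq> 0"
  shows "\<exists>\<phi> :: 'a \<Rightarrow>\<^sub>L real. \<phi> \<noteq> 0"
proof -
  obtain \<phi> where lin: "linear \<phi>" and le: "\<phi> \<le> lower_along norm e"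
    using hahn_banach_sublinear[OF sublinear_lower_along[OF sublinear_norm]] by blast
  interpret linear \<phi> by (rule lin)
  have le_norm: "\<phi> x \<le> norm x" for x
    using order_trans[OF le lower_along_le_self[OF sublinear_norm]] by (simp add: le_fun_def)
  have "\<bar>\<phi> x\<bar> \<le> norm x" for x
    using le_norm[of x] le_norm[of "- x"] by (simp add: neg abs_le_iff)
  then have bl: "bounded_linear \<phi>"
    by (intro bounded_linear_intro[where K = 1] add scale) simp
  have "\<phi> (- e) \<le> - norm e"
    using le lower_along_le[OF sublinear_norm, of 1 e "- e"]
    by (simp add: le_fun_def) (meson order_trans)
  moreover have "0 < norm e"
    using assms by simp
  ultimately have "\<phi> (- e) \<noteq> 0"
    by linarith
  then have "blinfun_apply (Blinfun \<phi>) (- e) \<noteq> 0"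
    using bl by (simp add: bounded_linear_Blinfun_apply)
  then have "Blinfun \<phi> \<noteq> 0"
    by (metis zero_blinfun.rep_eq)
  then show ?thesis ..
qed

section \<open>The norm of the cylindrified integral\<close>

lift_definition rank_one_operator ::
    "('a::real_normed_vector \<Rightarrow>\<^sub>L real) \<Rightarrow> 'b::real_normed_vector \<Rightarrow> 'a \<Rightarrow>\<^sub>L 'b"
  is "\<lambda>\<phi> x e. \<phi> e *\<^sub>R x"
  by (rule bounded_linear_scaleR_const)

lemma norm_rank_one_operator: "norm (rank_one_operator \<phi> x) = norm \<phi> * norm x"
  by transfer (rule onorm_scaleR_left)

lemma cylindrified_integral_eq_compose: "cylindrified_integral J = (o\<^sub>L) J"
  by (intro ext blinfun_eqI) (simp add: cylindrified_integral_apply)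

theorem theorem2p7:
  fixes B :: "'f::banach \<Rightarrow> 'g::banach \<Rightarrow> 'h::banach"
    and S :: "'s set" and M N :: "'s set set" and \<mu> :: "'s set \<Rightarrow> 'g"
    and emb :: "('s \<Rightarrow> 'f) \<Rightarrow> 'i::real_normed_vector"
    and J :: "'i \<Rightarrow>\<^sub>L 'h"
  assumes "bounded_bilinear B"
    and "algebra S M"
    and "additive M \<mu>"
    and "integrand_space S M N emb"
    and "extends_elementary_integral B M \<mu> emb J"
    and "\<exists>e::'e::banach. e \<noteq> 0"
  shows "bounded_linear (cylindrified_integral J :: ('e \<Rightarrow>\<^sub>L 'i) \<Rightarrow> ('e \<Rightarrow>\<^sub>L 'h)) \<and>
    onorm (cylindrified_integral J :: ('e \<Rightarrow>\<^sub>L 'i) \<Rightarrow> ('e \<Rightarrow>\<^sub>L 'h)) = onorm (blinfun_apply J)"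
proof -
  let ?T = "cylindrified_integral J :: ('e \<Rightarrow>\<^sub>L 'i) \<Rightarrow> ('e \<Rightarrow>\<^sub>L 'h)"
  have bl: "bounded_linear ?T"
    unfolding cylindrified_integral_eq_compose
    by (rule bounded_bilinear.bounded_linear_right[OF bounded_bilinear_blinfun_compose])
  obtain \<phi> :: "'e \<Rightarrow>\<^sub>L real" where "\<phi> \<noteq> 0"
    using assms(6) ex_nonzero_functional by blast
  have "onorm ?T \<le> onorm (blinfun_apply J)"
    using norm_blinfun_compose[of J]
    by (intro onorm_bound)
      (auto simp: cylindrified_integral_eq_compose norm_blinfun.rep_eq[symmetric])
  moreover have "onorm (blinfun_apply J) \<le> onorm ?T"
  proof (rule onorm_bound)
    show "0 \<le> onorm ?T" by (rule onorm_pos_le[OF bl])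
    fix x
    have "?T (rank_one_operator \<phi> x) = rank_one_operator \<phi> (J x)"
      by (rule blinfun_eqI)
        (simp add: cylindrified_integral_apply rank_one_operator.rep_eq blinfun.scaleR_right)
    then have "norm \<phi> * norm (J x) \<le> onorm ?T * (norm \<phi> * norm x)"
      using onorm[OF bl, of "rank_one_operator \<phi> x"] by (simp add: norm_rank_one_operator)
    with \<open>\<phi> \<noteq> 0\<close> show "norm (J x) \<le> onorm ?T * norm x"
      by (simp add: mult.left_commute)
  qed
  ultimately show ?thesis
    using bl by simp
qed

end
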